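(* Let $A$ be an almost Dedekind domain having only finitely many noninvertible maximal ideals. Then $A$ is an ISP-domain if and only if $A$ is an SP-domain.
   Context: All rings are commutative and unitary; "ideal" of a domain means integral ideal. A domain $A$ is almost Dedekind if for every maximal ideal $M$ of $A$ the localization $A_M$ is a rank one discrete valuation domain (DVR). A domain $A$ is an SP-domain if every ideal of $A$ is a (finite) product of radical ideals. A domain $A$ is an ISP-domain (invertible semiprime domain) if every proper nonzero ideal $I$ of $A$ can be written as $I=JQ_1\cdots Q_n$ where $n\geq 1$, $J$ is an invertible ideal of $A$ and each $Q_i$ is a proper radical ideal of $A$. *)

theory Defs
  imports "HOL-Computational_Algebra.Polynomial_Factorial"
begin

text \<open>
  The domain \<open>A\<close> is a type \<open>'a :: idom\<close>, and its quotient field is \<open>'a fract\<close>, with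
  \<^const>\<open>to_fract\<close> as the embedding. Ideals of \<open>A\<close> are the submodules of \<open>A\<close>, and fractional
  ideals are certain \<open>A\<close>-submodules of the quotient field, so both use the submodule
  notions (\<open>subspace\<close>, \<open>span\<close>) of \<^locale>\<open>module\<close>.
\<close>

text \<open>
  These facts are not turned into interpretations: the simp rules of \<^locale>\<open>module\<close> would
  reassociate multiplication in the ring itself and loop with \<open>ac_simps\<close>.
\<close>

lemma module_ring: "module ((*) :: 'a::comm_ring_1 \<Rightarrow> 'a \<Rightarrow> 'a)"
  by unfold_locales (simp_all add: distrib_left distrib_right mult.assoc)

abbreviation frac_scale :: "'a::idom \<Rightarrow> 'a fract \<Rightarrow> 'a fract" where
  "frac_scale \<equiv> \<lambda>a x. to_fract a * x"

lemma module_frac: "module (frac_scale :: 'a::idom \<Rightarrow> 'a fract \<Rightarrow> 'a fract)"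
  by unfold_locales (simp_all add: distrib_left distrib_right mult.assoc)

definition is_ideal :: "'a::comm_ring_1 set \<Rightarrow> bool" where
  "is_ideal I \<longleftrightarrow> module.subspace (*) I"

definition maximal_ideal :: "'a::comm_ring_1 set \<Rightarrow> bool" where
  "maximal_ideal M \<longleftrightarrow>
     is_ideal M \<and> M \<noteq> UNIV \<and> (\<forall>I. is_ideal I \<and> M \<subseteq> I \<longrightarrow> I = M \<or> I = UNIV)"

definition radical :: "'a::comm_ring_1 set \<Rightarrow> 'a set" where
  "radical I = {x. \<exists>n>0. x ^ n \<in> I}"

text \<open>The unit ideal counts as radical; properness is required separately where needed.\<close>

definition radical_ideal :: "'a::comm_ring_1 set \<Rightarrow> bool" where
  "radical_ideal I \<longleftrightarrow> is_ideal I \<and> radical I = I"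

definition ideal_mult :: "'a::comm_ring_1 set \<Rightarrow> 'a set \<Rightarrow> 'a set" where
  "ideal_mult I J = module.span (*) {a * b | a b. a \<in> I \<and> b \<in> J}"

definition ideal_prod_list :: "'a::comm_ring_1 set list \<Rightarrow> 'a set" where
  "ideal_prod_list Is = foldr ideal_mult Is UNIV"

definition fractional_ideal :: "'a::idom fract set \<Rightarrow> bool" where
  "fractional_ideal J \<longleftrightarrow>
     module.subspace frac_scale J \<and> (\<exists>d. d \<noteq> 0 \<and> (\<forall>x\<in>J. to_fract d * x \<in> range to_fract))"

definition frac_mult :: "'a::idom fract set \<Rightarrow> 'a fract set \<Rightarrow> 'a fract set" where
  "frac_mult I J = module.span frac_scale {x * y | x y. x \<in> I \<and> y \<in> J}"

definition invertible_ideal :: "'a::idom set \<Rightarrow> bool" where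
  "invertible_ideal I \<longleftrightarrow>
     is_ideal I \<and> (\<exists>J. fractional_ideal J \<and> frac_mult (to_fract ` I) J = range to_fract)"

text \<open>The localization of \<open>A\<close> at a prime ideal \<open>P\<close>, as a subring of the quotient field.\<close>

definition localization :: "'a::idom set \<Rightarrow> 'a fract set" where
  "localization P = {Fract a s | a s. s \<notin> P}"

text \<open>
  A subset \<open>V\<close> of a field is a rank one discrete valuation domain (with that field as its
  quotient field) if it is the valuation ring of a surjective valuation onto the integers.
  The value at \<open>0\<close>, conventionally infinite, is left unspecified. Fields are excluded.
\<close>

definition discrete_valuation :: "('k::field \<Rightarrow> int) \<Rightarrow> bool" where
  "discrete_valuation v \<longleftrightarrow>
     (\<forall>x y. x \<noteq> 0 \<and> y \<noteq> 0 \<longrightarrow> v (x * y) = v x + v y) \<and>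
     (\<forall>x y. x \<noteq> 0 \<and> y \<noteq> 0 \<and> x + y \<noteq> 0 \<longrightarrow> v (x + y) \<ge> min (v x) (v y)) \<and>
     v ` (- {0}) = UNIV"

definition is_dvr :: "'k::field set \<Rightarrow> bool" where
  "is_dvr V \<longleftrightarrow> (\<exists>v. discrete_valuation v \<and> V = {x. x = 0 \<or> v x \<ge> 0})"

definition almost_dedekind :: "'a::idom itself \<Rightarrow> bool" where
  "almost_dedekind _ \<longleftrightarrow> (\<forall>M :: 'a set. maximal_ideal M \<longrightarrow> is_dvr (localization M))"

definition sp_domain :: "'a::idom itself \<Rightarrow> bool" where
  "sp_domain _ \<longleftrightarrow>
     (\<forall>I :: 'a set. is_ideal I \<longrightarrow>
        (\<exists>Qs. (\<forall>Q \<in> set Qs. radical_ideal Q) \<and> I = ideal_prod_list Qs))"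

definition isp_domain :: "'a::idom itself \<Rightarrow> bool" where
  "isp_domain _ \<longleftrightarrow>
     (\<forall>I :: 'a set. is_ideal I \<and> I \<noteq> UNIV \<and> I \<noteq> {0} \<longrightarrow>
        (\<exists>J Qs. invertible_ideal J \<and> Qs \<noteq> [] \<and>
           (\<forall>Q \<in> set Qs. radical_ideal Q \<and> Q \<noteq> UNIV) \<and>
           I = ideal_mult J (ideal_prod_list Qs)))"

end

theory Submission
  imports Defs "HOL-Library.Countable_Set" "HOL-Library.Extended_Nat"
begin

text \<open>
  In an almost Dedekind domain, ideals are determined by their values at the maximal ideals.
  The function \<open>N \<mapsto> val N z\<close> is upper semicontinuous at \<open>M\<close> as soon as some \<open>x\<close> has value \<open>1\<close> at
  \<open>M\<close> and at most \<open>1\<close> on a neighbourhood of \<open>M\<close>. If this holds at every \<open>M\<close>, the values of a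
  nonzero ideal \<open>I\<close> are bounded and \<open>I\<close> is the product of the radical ideals
  \<open>Q\<^sub>k = \<Inter>{N. I has value \<ge> k at N}\<close>. An invertible maximal ideal has such an \<open>x\<close> because it is an
  isolated point of every closed set \<open>{N. x \<in> N}\<close> with \<open>x \<noteq> 0\<close>. For a noninvertible one, ISP
  must be used, applied to a nonprincipal ideal; finiteness allows choosing \<open>x\<close> outside all other
  noninvertible maximal ideals.
\<close>

section \<open>Ideals\<close>

lemma is_ideal_iff:
  "is_ideal I \<longleftrightarrow> 0 \<in> I \<and> (\<forall>a\<in>I. \<forall>b\<in>I. a + b \<in> I) \<and> (\<forall>r. \<forall>a\<in>I. r * a \<in> I)"
  unfolding is_ideal_def module.subspace_def[OF module_ring] by blast

lemma ideal_0: "is_ideal I \<Longrightarrow> 0 \<in> I"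
  and ideal_add: "is_ideal I \<Longrightarrow> a \<in> I \<Longrightarrow> b \<in> I \<Longrightarrow> a + b \<in> I"
  and ideal_mult_left: "is_ideal I \<Longrightarrow> a \<in> I \<Longrightarrow> r * a \<in> I"
  by (auto simp: is_ideal_iff)

lemma ideal_mult_right: "is_ideal I \<Longrightarrow> a \<in> I \<Longrightarrow> a * r \<in> I"
  by (metis ideal_mult_left mult.commute)

lemma ideal_eq_UNIV: "is_ideal I \<Longrightarrow> 1 \<in> I \<Longrightarrow> I = UNIV"
  using ideal_mult_left[of I 1] by auto

lemma is_ideal_UNIV: "is_ideal UNIV"
  by (simp add: is_ideal_iff)

lemma ideal_quotient: "is_ideal I \<Longrightarrow> is_ideal {s. s * y \<in> I}"
  by (auto simp: is_ideal_iff distrib_right mult.assoc)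

section \<open>Products of ideals\<close>

lemma is_ideal_ideal_mult: "is_ideal (ideal_mult I J)"
  unfolding is_ideal_def ideal_mult_def by (rule module.subspace_span[OF module_ring])

lemma ideal_multI: "a \<in> I \<Longrightarrow> b \<in> J \<Longrightarrow> a * b \<in> ideal_mult I J"
  unfolding ideal_mult_def by (rule module.span_base[OF module_ring]) blast

lemma ideal_mult_subset:
  assumes "is_ideal K" "\<And>a b. a \<in> I \<Longrightarrow> b \<in> J \<Longrightarrow> a * b \<in> K"
  shows "ideal_mult I J \<subseteq> K"
  unfolding ideal_mult_def
  by (rule module.span_minimal[OF module_ring]) (use assms in \<open>auto simp: is_ideal_def\<close>)

lemma ideal_mult_le_left: "is_ideal I \<Longrightarrow> ideal_mult I J \<subseteq> I"
  by (rule ideal_mult_subset) (auto intro: ideal_mult_right)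

lemma ideal_mult_le_right: "is_ideal J \<Longrightarrow> ideal_mult I J \<subseteq> J"
  by (rule ideal_mult_subset) (auto intro: ideal_mult_left)

lemma ideal_mult_UNIV: "is_ideal J \<Longrightarrow> ideal_mult UNIV J = J"
  using ideal_mult_le_right[of J UNIV] ideal_multI[of 1 UNIV _ J] by auto

lemma ideal_prod_list_Nil [simp]: "ideal_prod_list [] = UNIV"
  by (simp add: ideal_prod_list_def)

lemma ideal_prod_list_Cons [simp]:
  "ideal_prod_list (I # Is) = ideal_mult I (ideal_prod_list Is)"
  by (simp add: ideal_prod_list_def)

lemma is_ideal_ideal_prod_list: "is_ideal (ideal_prod_list Is)"
  by (cases Is) (simp_all add: is_ideal_UNIV is_ideal_ideal_mult)

lemma ideal_prod_list_subset:
  assumes "I \<in> set Is" "\<And>J. J \<in> set Is \<Longrightarrow> is_ideal J"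
  shows "ideal_prod_list Is \<subseteq> I"
  using assms
proof (induction Is)
  case (Cons K Is)
  then consider "I = K" | "I \<in> set Is" by auto
  then show ?case
  proof cases
    case 1
    then show ?thesis using Cons.prems ideal_mult_le_left[of K] by simp
  next
    case 2
    then have "ideal_prod_list Is \<subseteq> I" using Cons by simp
    then show ?thesis
      using ideal_mult_le_right[OF is_ideal_ideal_prod_list, of K Is] by simp
  qed
qed simp

lemma ideal_prod_list_filter_UNIV:
  "ideal_prod_list (filter (\<lambda>I. I \<noteq> UNIV) Is) = ideal_prod_list Is"
  by (induction Is) (auto simp: ideal_mult_UNIV is_ideal_ideal_prod_list)

section \<open>Maximal ideals\<close>

lemma maximal_idealD:
  "maximal_ideal M \<Longrightarrow> is_ideal M"
  "maximal_ideal M \<Longrightarrow> is_ideal I \<Longrightarrow> M \<subseteq> I \<Longrightarrow> I = M \<or> I = UNIV"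
  by (auto simp: maximal_ideal_def)

lemma one_notin_maximal: "maximal_ideal M \<Longrightarrow> 1 \<notin> M"
  using ideal_eq_UNIV by (auto simp: maximal_ideal_def)

lemma maximal_ideal_comaximal:
  assumes "maximal_ideal M" "maximal_ideal N" "M \<noteq> N"
  obtains a where "a \<in> N" "1 - a \<in> M"
proof -
  \<comment> \<open>\<open>?S\<close> is the sum of \<open>M\<close> and \<open>N\<close>; it
    contains \<open>M\<close> properly, so it is the whole ring.\<close>
  let ?S = "{y. \<exists>a\<in>N. y - a \<in> M}"
  have id: "is_ideal M" "is_ideal N" using assms maximal_idealD by auto
  have "is_ideal ?S"
    unfolding is_ideal_iff
  proof (intro conjI ballI allI)
    show "0 \<in> ?S" using ideal_0[OF id(1)] ideal_0[OF id(2)] by force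
  next
    fix x y assume "x \<in> ?S" "y \<in> ?S"
    then obtain a b where ab: "a \<in> N" "b \<in> N" "x - a \<in> M" "y - b \<in> M" by auto
    then have "(x - a) + (y - b) \<in> M" "a + b \<in> N" using id ideal_add by auto
    moreover have "(x - a) + (y - b) = (x + y) - (a + b)" by simp
    ultimately show "x + y \<in> ?S" by (metis (mono_tags, lifting) mem_Collect_eq)
  next
    fix r x assume "x \<in> ?S"
    then obtain a where "a \<in> N" "x - a \<in> M" by auto
    then have "r * a \<in> N" "r * (x - a) \<in> M" using id ideal_mult_left by auto
    then show "r * x \<in> ?S" by (auto simp: right_diff_distrib)
  qed
  moreover have "M \<subseteq> ?S" using ideal_0[OF id(2)] by force
  moreover have "N \<subseteq> ?S" using ideal_0[OF id(1)] by force
  moreover have "\<not> N \<subseteq> M"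
    using assms maximal_idealD(2)[of N M] id by (auto simp: maximal_ideal_def)
  ultimately have "?S = UNIV" using maximal_idealD(2)[OF assms(1)] by blast
  then show ?thesis using that by blast
qed

lemma maximal_ideal_not_subset:
  assumes "maximal_ideal M" "maximal_ideal N" "M \<noteq> N"
  shows "\<exists>a\<in>N. a \<notin> M"
proof -
  obtain a where "a \<in> N" "1 - a \<in> M" using maximal_ideal_comaximal[OF assms] .
  then show ?thesis
    using ideal_add[of M "1 - a" a] assms(1) one_notin_maximal maximal_idealD(1) by fastforce
qed

lemma proper_ideal_le_maximal:
  assumes "is_ideal I" "1 \<notin> I"
  shows "\<exists>M. maximal_ideal M \<and> I \<subseteq> M"
proof -
  let ?A = "{K. is_ideal K \<and> I \<subseteq> K \<and> 1 \<notin> K}"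
  have "\<exists>M\<in>?A. \<forall>X\<in>?A. M \<subseteq> X \<longrightarrow> X = M"
  proof (rule subset_Zorn_nonempty)
    show "?A \<noteq> {}" using assms by auto
  next
    fix C assume C: "C \<noteq> {}" "subset.chain ?A C"
    then have CA: "C \<subseteq> ?A" and tot: "\<And>X Y. X \<in> C \<Longrightarrow> Y \<in> C \<Longrightarrow> X \<subseteq> Y \<or> Y \<subseteq> X"
      by (auto simp: subset_chain_def)
    have "is_ideal (\<Union>C)"
      unfolding is_ideal_iff
    proof (intro conjI ballI allI)
      show "0 \<in> \<Union>C" using C(1) CA ideal_0 by fast
    next
      fix a b assume "a \<in> \<Union>C" "b \<in> \<Union>C"
      then obtain X Y where "X \<in> C" "Y \<in> C" "a \<in> X" "b \<in> Y" by auto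
      with tot[of X Y] obtain Z where "Z \<in> C" "a \<in> Z" "b \<in> Z" by auto
      then show "a + b \<in> \<Union>C" using CA ideal_add[of Z a b] by auto
    next
      fix r a assume "a \<in> \<Union>C"
      then show "r * a \<in> \<Union>C" using CA ideal_mult_left by fast
    qed
    then show "\<Union>C \<in> ?A" using C(1) CA by auto
  qed
  then obtain M where M: "is_ideal M" "I \<subseteq> M" "1 \<notin> M"
    and max: "\<And>X. is_ideal X \<Longrightarrow> I \<subseteq> X \<Longrightarrow> 1 \<notin> X \<Longrightarrow> M \<subseteq> X \<Longrightarrow> X = M" by auto
  have "maximal_ideal M"
    unfolding maximal_ideal_def using M max ideal_eq_UNIV by blast
  with M show ?thesis by auto
qed

text \<open>The local-to-global tool: a claim about the ring is encoded as \<open>1\<close> lying in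
  an ideal of elements \<open>s\<close> for which the claim holds after localizing at
  \<open>s\<close>, and is then checked at each maximal ideal.\<close>

lemma one_in_ideal_if_avoids_maximals:
  assumes "is_ideal I" "\<And>M. maximal_ideal M \<Longrightarrow> \<exists>a\<in>I. a \<notin> M"
  shows "1 \<in> I"
  using proper_ideal_le_maximal[OF assms(1)] assms(2) by blast

section \<open>Invertible ideals\<close>

lemma invertible_ideal_UNIV: "invertible_ideal (UNIV :: 'a::idom set)"
proof -
  have r: "module.subspace frac_scale (range (to_fract :: 'a \<Rightarrow> _))"
    unfolding module.subspace_def[OF module_frac]
    by (auto simp flip: to_fract_add to_fract_mult to_fract_0)
  then have "fractional_ideal (range (to_fract :: 'a \<Rightarrow> _))"
    unfolding fractional_ideal_def by (auto simp flip: to_fract_mult intro!: exI[of _ 1])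
  moreover have "frac_mult (range to_fract) (range to_fract) = range (to_fract :: 'a \<Rightarrow> _)"
  proof
    show "frac_mult (range to_fract) (range to_fract) \<subseteq> range (to_fract :: 'a \<Rightarrow> _)"
      unfolding frac_mult_def
      by (rule module.span_minimal[OF module_frac _ r]) (auto simp flip: to_fract_mult)
    have "range (to_fract :: 'a \<Rightarrow> _)
        \<subseteq> {x * y |x y. x \<in> range to_fract \<and> y \<in> range to_fract}"
    proof
      fix u :: "'a fract" assume "u \<in> range to_fract"
      moreover have "u = u * 1" "1 \<in> range to_fract" by (simp, metis rangeI to_fract_1)
      ultimately show "u \<in> {x * y |x y. x \<in> range to_fract \<and> y \<in> range to_fract}" by blast
    qed
    then show "range (to_fract :: 'a \<Rightarrow> _) \<subseteq> frac_mult (range to_fract) (range to_fract)"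
      unfolding frac_mult_def using module.span_superset[OF module_frac] by blast
  qed
  ultimately show ?thesis
    unfolding invertible_ideal_def using is_ideal_UNIV by auto
qed

text \<open>The element \<open>y\<close> is taken from \<open>x J\<^sup>-\<^sup>1\<close>, an ideal whose product with \<open>J\<close> contains \<open>x\<close>.\<close>

lemma invertible_ideal_cofactor:
  assumes "invertible_ideal J" "x \<in> J" "is_ideal P" "x \<notin> ideal_mult J P"
  obtains y where "y \<notin> P" "\<And>j. j \<in> J \<Longrightarrow> x dvd y * j"
proof -
  obtain B where B: "frac_mult (to_fract ` J) B = range to_fract"
    using assms(1) by (auto simp: invertible_ideal_def)
  note thesisI = that
  have prod: "to_fract j * w \<in> range to_fract" if "j \<in> J" "w \<in> B" for j w
    unfolding B[symmetric] frac_mult_def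
    by (rule module.span_base[OF module_frac]) (use that in blast)
  show ?thesis
  proof (rule ccontr)
    assume no: "\<not> thesis"
    \<comment> \<open>If every admissible \<open>y\<close> lay in \<open>P\<close>, then
      \<open>x B \<subseteq> P\<close>. Since \<open>J B\<close> is the whole ring, \<open>x\<close>
      would lie in \<open>x J B \<subseteq> J P\<close>, against the assumption.\<close>
    have P: "to_fract x * w \<in> to_fract ` P" if w: "w \<in> B" for w
    proof -
      obtain y where y: "to_fract x * w = to_fract y" using prod[OF assms(2) w] by auto
      have "x dvd y * j" if j: "j \<in> J" for j
      proof -
        obtain c where c: "to_fract j * w = to_fract c" using prod[OF j w] by auto
        have "to_fract (y * j) = to_fract x * (to_fract j * w)"
          using y by (simp add: mult.commute mult.left_commute)
        then have "to_fract (y * j) = to_fract (x * c)" using c by simp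
        then show ?thesis by (simp only: to_fract_eq_iff dvd_triv_left)
      qed
      then have "y \<in> P" using no thesisI by blast
      then show ?thesis using y by simp
    qed
    let ?K = "{u. to_fract x * u \<in> to_fract ` ideal_mult J P}"
    have id: "is_ideal (ideal_mult J P)" by (rule is_ideal_ideal_mult)
    have "module.subspace frac_scale ?K"
      unfolding module.subspace_def[OF module_frac]
    proof (intro conjI ballI allI)
      show "0 \<in> ?K" using ideal_0[OF id] by (force simp flip: to_fract_0)
    next
      fix u v assume "u \<in> ?K" "v \<in> ?K"
      then show "u + v \<in> ?K"
        using ideal_add[OF id] by (auto simp: distrib_left simp flip: to_fract_add)
    next
      fix c u assume "u \<in> ?K"
      then show "to_fract c * u \<in> ?K"
        using ideal_mult_left[OF id] by (auto simp: mult.left_commute simp flip: to_fract_mult)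
    qed
    moreover have "{a * w | a w. a \<in> to_fract ` J \<and> w \<in> B} \<subseteq> ?K"
    proof clarsimp
      fix j w assume "j \<in> J" "w \<in> B"
      then obtain p where "p \<in> P" "to_fract x * w = to_fract p" using P by auto
      then have "to_fract x * (to_fract j * w) = to_fract (j * p)"
        by (simp add: mult.left_commute)
      then show "to_fract x * (to_fract j * w) \<in> to_fract ` ideal_mult J P"
        using ideal_multI \<open>j \<in> J\<close> \<open>p \<in> P\<close> by blast
    qed
    ultimately have "frac_mult (to_fract ` J) B \<subseteq> ?K"
      unfolding frac_mult_def by (intro module.span_minimal[OF module_frac])
    then have "1 \<in> ?K" using B by (auto simp flip: to_fract_1)
    then show False using assms(4) by auto
  qed
qed

section \<open>The valuations of an almost Dedekind domain\<close>

text \<open>\<open>is_dvr\<close> only asserts that a valuation exists, so one is chosen; the two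
  properties under \<open>SOME\<close> are all that is used of it.\<close>

definition frac_val :: "'a::idom set \<Rightarrow> 'a fract \<Rightarrow> int" where
  "frac_val M = (SOME v. discrete_valuation v \<and> localization M = {x. x = 0 \<or> v x \<ge> 0})"

text \<open>The value \<infinity> at 0 lets the laws for products and sums hold without side
  conditions. Truncation by \<open>nat\<close> loses nothing at a maximal ideal, where ring elements
  have nonnegative value.\<close>

definition val :: "'a::idom set \<Rightarrow> 'a \<Rightarrow> enat" where
  "val M a = (if a = 0 then \<infinity> else enat (nat (frac_val M (to_fract a))))"

lemma val_eq_infinity [simp]: "val M a = \<infinity> \<longleftrightarrow> a = 0"
  by (simp add: val_def)

lemma val_0 [simp]: "val M 0 = \<infinity>"
  by simp

locale almost_dedekind_domain =
  fixes A :: "'a::idom itself"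
  assumes almost_dedekind: "almost_dedekind A"
begin

context
  fixes M :: "'a set"
  assumes M: "maximal_ideal M"
begin

lemma discrete_valuation_frac_val:
  "discrete_valuation (frac_val M)" (is ?v)
  and localization_eq: "localization M = {x. x = 0 \<or> frac_val M x \<ge> 0}" (is ?l)
proof -
  have "\<exists>v. discrete_valuation v \<and> localization M = {x. x = 0 \<or> v x \<ge> 0}"
    using almost_dedekind M by (auto simp: almost_dedekind_def is_dvr_def)
  then have "?v \<and> ?l"
    unfolding frac_val_def by (rule someI_ex)
  then show ?v ?l by auto
qed

lemma frac_val_mult: "x \<noteq> 0 \<Longrightarrow> y \<noteq> 0 \<Longrightarrow> frac_val M (x * y) = frac_val M x + frac_val M y"
  and frac_val_add:
    "x \<noteq> 0 \<Longrightarrow> y \<noteq> 0 \<Longrightarrow> x + y \<noteq> 0 \<Longrightarrow> min (frac_val M x) (frac_val M y) \<le> frac_val M (x + y)"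
  using discrete_valuation_frac_val by (auto simp: discrete_valuation_def)

lemma localizationE:
  assumes "x \<in> localization M"
  obtains a s where "s \<notin> M" "s \<noteq> 0" "x * to_fract s = to_fract a"
proof -
  obtain a s where "x = Fract a s" "s \<notin> M" using assms by (auto simp: localization_def)
  moreover from this have "s \<noteq> 0" using ideal_0 M maximal_idealD(1) by blast
  ultimately show ?thesis using that by (simp add: Fract_conv_to_fract)
qed

lemma frac_val_to_fract_nonneg: "a \<noteq> 0 \<Longrightarrow> 0 \<le> frac_val M (to_fract a)"
proof -
  assume "a \<noteq> 0"
  have "to_fract a = Fract a 1" by (simp add: Fract_conv_to_fract)
  then have "to_fract a \<in> localization M"
    unfolding localization_def using one_notin_maximal[OF M] by blast
  then show ?thesis using localization_eq \<open>a \<noteq> 0\<close> by auto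
qed

lemma val_mult: "val M (a * b) = val M a + val M b"
  using frac_val_to_fract_nonneg[of a] frac_val_to_fract_nonneg[of b]
  by (auto simp: val_def frac_val_mult nat_add_distrib)

lemma val_add: "min (val M a) (val M b) \<le> val M (a + b)"
proof (cases "a = 0 \<or> b = 0 \<or> a + b = 0")
  case False
  then have "min (frac_val M (to_fract a)) (frac_val M (to_fract b)) \<le> frac_val M (to_fract (a + b))"
    using frac_val_add[of "to_fract a" "to_fract b"]
    by (simp flip: to_fract_add)
  with False show ?thesis by (auto simp: val_def min_def nat_mono split: if_splits)
qed (auto simp: min_def)

lemma frac_val_1: "frac_val M 1 = 0"
  using frac_val_mult[of 1 1] by simp

lemma val_1 [simp]: "val M 1 = 0"
  by (simp add: val_def frac_val_1 zero_enat_def)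

text \<open>Value 0 means being a unit of the localization: an inverse \<open>b / s\<close> with
  \<open>s \<notin> M\<close> gives \<open>s = b * a\<close>, which keeps \<open>a\<close> out of
  \<open>M\<close>.\<close>

lemma val_eq_0_iff: "val M a = 0 \<longleftrightarrow> a \<notin> M"
proof (cases "a = 0")
  case True
  then show ?thesis using ideal_0 M maximal_idealD(1) by auto
next
  case False
  have inv: "frac_val M (inverse (to_fract a)) = - frac_val M (to_fract a)"
    using frac_val_mult[of "to_fract a" "inverse (to_fract a)"] False frac_val_1 by simp
  have "frac_val M (to_fract a) = 0 \<longleftrightarrow> a \<notin> M"
  proof
    assume "a \<notin> M"
    moreover have "inverse (to_fract a) = Fract 1 a"
      by (simp add: Fract_conv_to_fract inverse_eq_divide)
    ultimately have "inverse (to_fract a) \<in> localization M"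
      unfolding localization_def by blast
    then have "0 \<le> frac_val M (inverse (to_fract a))" using localization_eq False by auto
    then show "frac_val M (to_fract a) = 0" using inv frac_val_to_fract_nonneg[OF False] by auto
  next
    assume "frac_val M (to_fract a) = 0"
    then have "inverse (to_fract a) \<in> localization M" using localization_eq inv by auto
    then obtain b s where s: "s \<notin> M" "inverse (to_fract a) * to_fract s = to_fract b"
      by (rule localizationE)
    then have "to_fract s = to_fract (b * a)" using False by (simp add: field_simps)
    then have "s = b * a" by (simp only: to_fract_eq_iff)
    then show "a \<notin> M" using s(1) ideal_mult_left[OF maximal_idealD(1)[OF M]] by blast
  qed
  then show ?thesis
    using frac_val_to_fract_nonneg[OF False] False by (auto simp: val_def zero_enat_def)
qed

lemma one_le_val_iff: "1 \<le> val M a \<longleftrightarrow> a \<in> M"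
  using val_eq_0_iff[of a] by (cases "val M a") (auto simp: one_enat_def zero_enat_def)

text \<open>Surjectivity of the valuation gives a fraction of value 1; its denominator lies outside
  \<open>M\<close> and has value 0, so the numerator has value 1.\<close>

lemma uniformizer: "\<exists>p. val M p = 1"
proof -
  have "1 \<in> frac_val M ` (- {0})"
    using discrete_valuation_frac_val by (auto simp: discrete_valuation_def)
  then obtain x where x: "x \<noteq> 0" "frac_val M x = 1" by force
  then have "x \<in> localization M" using localization_eq by auto
  then obtain a s where s: "s \<notin> M" "s \<noteq> 0" "x * to_fract s = to_fract a" by (rule localizationE)
  have "val M s = 0" using s val_eq_0_iff by simp
  then have "frac_val M (to_fract s) = 0"
    using s frac_val_to_fract_nonneg[of s] by (simp add: val_def zero_enat_def)
  then have "frac_val M (to_fract a) = 1" using frac_val_mult[of x "to_fract s"] x s by simp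
  moreover have "a \<noteq> 0" using s x by auto
  ultimately show ?thesis by (intro exI[of _ a]) (simp add: val_def one_enat_def)
qed

text \<open>The quotient \<open>a / b\<close> lies in the localization. Clearing its denominator
  turns an inequality of values into an equation in the ring.\<close>

lemma val_le_imp_locally_dvd:
  assumes "val M b \<le> val M a"
  shows "\<exists>s c. s \<notin> M \<and> s * a = c * b"
proof (cases "a = 0")
  case True
  then show ?thesis
    using one_notin_maximal[OF M] by (intro exI[of _ 1] exI[of _ 0]) simp
next
  case False
  then have b: "b \<noteq> 0" using assms by auto
  have "frac_val M (to_fract b) \<le> frac_val M (to_fract a)"
    using assms False b frac_val_to_fract_nonneg[of a] frac_val_to_fract_nonneg[of b]
    by (simp add: val_def)
  moreover have "frac_val M (to_fract a / to_fract b) = frac_val M (to_fract a) - frac_val M (to_fract b)"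
    using frac_val_mult[of "to_fract a / to_fract b" "to_fract b"] False b by simp
  ultimately have "to_fract a / to_fract b \<in> localization M"
    using localization_eq by auto
  then obtain c s where "s \<notin> M" "s \<noteq> 0" "to_fract a / to_fract b * to_fract s = to_fract c"
    by (rule localizationE)
  then have "s \<notin> M" "to_fract (s * a) = to_fract (c * b)"
    using b by (auto simp: field_simps)
  then show ?thesis using to_fract_eq_iff by blast
qed

section \<open>Ideals seen at one maximal ideal\<close>

lemma is_ideal_val_ge: "is_ideal {a. k \<le> val M a}"
  unfolding is_ideal_iff
proof (intro conjI ballI allI)
  fix a b assume "a \<in> {a. k \<le> val M a}" "b \<in> {a. k \<le> val M a}"
  then have "k \<le> min (val M a) (val M b)" by simp
  then show "a + b \<in> {a. k \<le> val M a}" using val_add order_trans by blast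
qed (auto simp: val_mult add_increasing)

lemma val_power: "val M (a ^ n) = of_nat n * val M a"
  by (induction n) (auto simp: val_mult distrib_right)

lemma maximal_ideal_prime: "a * b \<in> M \<longleftrightarrow> a \<in> M \<or> b \<in> M"
proof -
  have "a * b \<notin> M \<longleftrightarrow> a \<notin> M \<and> b \<notin> M"
    unfolding val_eq_0_iff[symmetric] val_mult by simp
  then show ?thesis by blast
qed

lemma maximal_ideal_prod: "finite S \<Longrightarrow> prod f S \<in> M \<longleftrightarrow> (\<exists>i\<in>S. f i \<in> M)"
  by (induction S rule: finite_induct) (auto simp: maximal_ideal_prime one_notin_maximal[OF M])

lemma maximal_ideal_power: "0 < n \<Longrightarrow> a ^ n \<in> M \<longleftrightarrow> a \<in> M"
proof (induction n)
  case (Suc n)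
  then show ?case by (cases n) (auto simp: maximal_ideal_prime)
qed simp

lemma ideal_mult_subset_val_2:
  "I \<subseteq> M \<Longrightarrow> J \<subseteq> M \<Longrightarrow> ideal_mult I J \<subseteq> {a. 2 \<le> val M a}"
proof (rule ideal_mult_subset[OF is_ideal_val_ge])
  fix a b assume "I \<subseteq> M" "J \<subseteq> M" "a \<in> I" "b \<in> J"
  then have "1 \<le> val M a" "1 \<le> val M b" using one_le_val_iff by auto
  then show "a * b \<in> {a. 2 \<le> val M a}" using add_mono[of 1 "val M a" 1 "val M b"] by (simp add: val_mult)
qed

text \<open>A nonzero radical ideal of a DVR is the whole ring or the maximal ideal. Concretely, a
  uniformizer times some \<open>s \<notin> M\<close> has a power divisible by
  \<open>x\<close>.\<close>

lemma radical_ideal_val_le_1: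
  assumes Q: "radical_ideal Q" and x: "x \<in> Q" "x \<noteq> 0"
  shows "\<exists>q\<in>Q. val M q \<le> 1"
proof -
  obtain n where n: "val M x = enat n" using x(2) val_eq_infinity by (cases "val M x") auto
  have id: "is_ideal Q" using Q by (simp add: radical_ideal_def)
  obtain p where p: "val M p = 1" using uniformizer by blast
  \<comment> \<open>The exponent \<open>Suc n\<close> rather than \<open>n\<close> stays positive
    when \<open>n = 0\<close>, as \<open>radical\<close> demands.\<close>
  have "val M x \<le> val M (p ^ Suc n)"
    by (simp add: val_power p n of_nat_eq_enat del: power_Suc of_nat_Suc)
  then obtain s c where s: "s \<notin> M" "s * p ^ Suc n = c * x" using val_le_imp_locally_dvd by blast
  have "(s * p) ^ Suc n = s ^ n * (s * p ^ Suc n)"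
    by (simp add: power_mult_distrib mult_ac)
  also have "\<dots> = s ^ n * c * x" using s(2) by (simp only: mult.assoc)
  also have "\<dots> \<in> Q" using id x(1) by (rule ideal_mult_left)
  finally have "s * p \<in> radical Q" unfolding radical_def by blast
  then have "s * p \<in> Q" using Q by (simp add: radical_ideal_def)
  moreover have "val M (s * p) \<le> 1" using val_eq_0_iff[of s] s(1) p by (simp add: val_mult)
  ultimately show ?thesis by blast
qed

end

text \<open>At each \<open>M\<close> the element \<open>z\<close> divides \<open>y\<close> up to a
  factor outside \<open>M\<close>, so the ideal of all \<open>s\<close> with
  \<open>s * y \<in> I\<close> lies in no maximal ideal. Thus ideals are determined by their
  values.\<close>

lemma ideal_mem_if_val:
  assumes "is_ideal I" "\<And>M :: 'a set. maximal_ideal M \<Longrightarrow> \<exists>z\<in>I. val M z \<le> val M y"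
  shows "y \<in> I"
proof -
  have "1 \<in> {s. s * y \<in> I}"
  proof (rule one_in_ideal_if_avoids_maximals[OF ideal_quotient[OF assms(1)]])
    fix M :: "'a set" assume M: "maximal_ideal M"
    then obtain z where "z \<in> I" "val M z \<le> val M y" using assms(2) by blast
    then obtain s c where "s \<notin> M" "s * y = c * z" using val_le_imp_locally_dvd M by blast
    then show "\<exists>s\<in>{s. s * y \<in> I}. s \<notin> M"
      using ideal_mult_left[OF assms(1) \<open>z \<in> I\<close>, of c] by (intro bexI[of _ s]) auto
  qed
  then show ?thesis by simp
qed

section \<open>Noncritical maximal ideals\<close>

text \<open>For a maximal ideal of an almost Dedekind domain, this is equivalent to not being critical
  in Olberding's sense: some finitely generated ideal in \<open>M\<close> lies in no square of a maximal ideal.\<close>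

definition noncritical :: "'a set \<Rightarrow> bool" where
  "noncritical M \<longleftrightarrow>
     (\<exists>x s. val M x = 1 \<and> s \<notin> M \<and> (\<forall>N. maximal_ideal N \<and> s \<notin> N \<longrightarrow> val N x \<le> 1))"

text \<open>Upper semicontinuity of \<open>N \<mapsto> val N z\<close> at \<open>M\<close>, for the Zariski topology.\<close>

lemma noncritical_val_le:
  assumes "maximal_ideal M" "noncritical M"
  shows "\<exists>s. s \<notin> M \<and> (\<forall>N. maximal_ideal N \<and> s \<notin> N \<longrightarrow> val N z \<le> val M z)"
proof (cases "val M z")
  case infinity
  then show ?thesis using one_notin_maximal[OF assms(1)] by (intro exI[of _ 1]) auto
next
  case (enat n)
  obtain x s where x: "val M x = 1" "s \<notin> M"
    "\<And>N. maximal_ideal N \<Longrightarrow> s \<notin> N \<Longrightarrow> val N x \<le> 1"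
    using assms(2) unfolding noncritical_def by blast
  \<comment> \<open>With \<open>n\<close> the value of \<open>z\<close> at \<open>M\<close>,
    \<open>z\<close> divides \<open>x ^ n\<close> near \<open>M\<close>, where \<open>x\<close> has
    value at most 1; this bounds the value of \<open>z\<close> by \<open>n\<close>.\<close>
  have "val M z \<le> val M (x ^ n)" using assms(1) x(1) enat by (simp add: val_power of_nat_eq_enat)
  then obtain t c where t: "t \<notin> M" "t * x ^ n = c * z"
    using val_le_imp_locally_dvd[OF assms(1)] by blast
  have "val N z \<le> val M z" if N: "maximal_ideal N" "s * t \<notin> N" for N
  proof -
    have "s \<notin> N" "t \<notin> N" using N maximal_ideal_prime by auto
    have "val N z \<le> val N (c * z)" using N by (simp add: val_mult add_increasing)
    also have "\<dots> = val N t + of_nat n * val N x"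
      using N by (simp add: t(2)[symmetric] val_mult val_power)
    also have "\<dots> = of_nat n * val N x" using \<open>t \<notin> N\<close> val_eq_0_iff[OF N(1)] by simp
    also have "\<dots> \<le> of_nat n * 1" using x(3)[OF N(1) \<open>s \<notin> N\<close>] by (intro mult_left_mono) auto
    finally show ?thesis using enat by (simp add: of_nat_eq_enat)
  qed
  moreover have "s * t \<notin> M" using maximal_ideal_prime[OF assms(1)] x(2) t(1) by simp
  ultimately show ?thesis by blast
qed

text \<open>Semicontinuity bounds the values of \<open>z\<close> near each \<open>M\<close> by the
  finite value at \<open>M\<close>; compactness makes the bound uniform.\<close>

lemma val_bounded:
  assumes nc: "\<And>M :: 'a set. maximal_ideal M \<Longrightarrow> noncritical M" and "(z :: 'a) \<noteq> 0"
  shows "\<exists>B. \<forall>N. maximal_ideal N \<longrightarrow> val N z \<le> enat B"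
proof -
  let ?U = "{s. \<exists>B. \<forall>N. maximal_ideal N \<and> s \<notin> N \<longrightarrow> val N z \<le> enat B}"
  have "is_ideal ?U"
    unfolding is_ideal_iff
  proof (intro conjI ballI allI)
    show "0 \<in> ?U" using maximal_idealD(1) ideal_0 by blast
  next
    fix s t assume "s \<in> ?U" "t \<in> ?U"
    then obtain B C where *: "\<And>N. maximal_ideal N \<Longrightarrow> s \<notin> N \<Longrightarrow> val N z \<le> enat B"
      "\<And>N. maximal_ideal N \<Longrightarrow> t \<notin> N \<Longrightarrow> val N z \<le> enat C" by auto
    have "val N z \<le> enat (max B C)" if "maximal_ideal N" "s + t \<notin> N" for N
    proof -
      have "s \<notin> N \<or> t \<notin> N" using that maximal_idealD(1) ideal_add by blast
      then have "val N z \<le> enat B \<or> val N z \<le> enat C" using * that by blast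
      then show ?thesis by (auto elim!: order_trans)
    qed
    then show "s + t \<in> ?U" by blast
  next
    fix r s assume "s \<in> ?U"
    then obtain B where "\<And>N. maximal_ideal N \<Longrightarrow> s \<notin> N \<Longrightarrow> val N z \<le> enat B" by auto
    then have "\<forall>N. maximal_ideal N \<and> r * s \<notin> N \<longrightarrow> val N z \<le> enat B"
      using maximal_ideal_prime by auto
    then show "r * s \<in> ?U" by blast
  qed
  moreover have "\<exists>s\<in>?U. s \<notin> M" if M: "maximal_ideal M" for M
  proof -
    obtain n where n: "val M z = enat n" using assms(2) val_eq_infinity by (cases "val M z") auto
    obtain s where "s \<notin> M" "\<forall>N. maximal_ideal N \<and> s \<notin> N \<longrightarrow> val N z \<le> val M z"
      using noncritical_val_le[OF M nc[OF M]] by blast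
    then show ?thesis unfolding n by blast
  qed
  ultimately have "1 \<in> ?U" by (rule one_in_ideal_if_avoids_maximals)
  then show ?thesis using one_notin_maximal by blast
qed

text \<open>Semicontinuity is what gives \<open>Q\<^sub>k\<close> the value \<open>0\<close> at the maximal ideals where \<open>I\<close> has value
  less than \<open>k\<close>.\<close>

lemma product_of_radicals_if_noncritical:
  assumes nc: "\<And>M :: 'a set. maximal_ideal M \<Longrightarrow> noncritical M"
    and I: "is_ideal (I :: 'a set)" and x: "x \<in> I" "x \<noteq> 0"
  shows "\<exists>Qs. (\<forall>Q\<in>set Qs. radical_ideal Q) \<and> I = ideal_prod_list Qs"
proof -
  \<comment> \<open>\<open>W N\<close> is the value of \<open>I\<close> at \<open>N\<close>; the
    minimum is attained since \<open>x \<in> I\<close> has finite value there.\<close>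
  define W where "W N = (LEAST n. \<exists>z\<in>I. val N z \<le> enat n)" for N
  define Q where "Q k = {y. \<forall>N. maximal_ideal N \<and> k \<le> W N \<longrightarrow> y \<in> N}" for k
  obtain B where B: "\<And>N. maximal_ideal N \<Longrightarrow> val N x \<le> enat B" using val_bounded[OF nc x(2)] by blast
  have W_le: "W N \<le> n" if "z \<in> I" "val N z \<le> enat n" for N z n
    unfolding W_def using that by (intro Least_le) auto
  have W_attained: "\<exists>z\<in>I. val N z \<le> enat (W N)" if "maximal_ideal N" for N
    unfolding W_def
    using LeastI_ex[of "\<lambda>n. \<exists>z\<in>I. val N z \<le> enat n"] B[OF that] x(1) by blast
  have le_val: "enat (W N) \<le> val N z" if "z \<in> I" for N z
    using W_le[OF that, of N] by (cases "val N z") auto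
  have WB: "W N \<le> B" if "maximal_ideal N" for N using W_le[OF x(1) B[OF that]] .
  have idQ: "is_ideal (Q k)" for k
    unfolding is_ideal_iff Q_def
    by (auto dest: maximal_idealD(1) intro: ideal_0 ideal_add ideal_mult_left)
  have radQ: "radical_ideal (Q k)" for k
  proof -
    have "radical (Q k) \<subseteq> Q k" unfolding radical_def Q_def using maximal_ideal_power by auto
    moreover have "Q k \<subseteq> radical (Q k)" unfolding radical_def by (auto intro!: exI[of _ 1])
    ultimately show ?thesis using idQ by (auto simp: radical_ideal_def)
  qed
  \<comment> \<open>Together with the trivial lower bound, \<open>Q k\<close> has value exactly 1 at
    \<open>N\<close> if \<open>k \<le> W N\<close> and 0 otherwise. Hence a product of several
    \<open>Q k\<close> has as value the number of indices \<open>k \<le> W N\<close>.\<close>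
  have one: "\<exists>q\<in>Q k. val N q \<le> (if k \<le> W N then 1 else 0)" if N: "maximal_ideal N" and "0 < k" for N k
  proof (cases "k \<le> W N")
    case True
    have "x \<in> Q k"
      unfolding Q_def
    proof clarsimp
      fix M assume M: "maximal_ideal M" "k \<le> W M"
      then have "1 \<le> enat (W M)" using \<open>0 < k\<close> by (simp add: one_enat_def)
      then have "1 \<le> val M x" using le_val[OF x(1)] order_trans by blast
      then show "x \<in> M" using one_le_val_iff[OF M(1)] by simp
    qed
    then show ?thesis using radical_ideal_val_le_1[OF N radQ _ x(2)] True by auto
  next
    case False
    obtain z where z: "z \<in> I" "val N z \<le> enat (W N)" using W_attained[OF N] by blast
    obtain s where s: "s \<notin> N" "\<And>M. maximal_ideal M \<Longrightarrow> s \<notin> M \<Longrightarrow> val M z \<le> val N z"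
      using noncritical_val_le[OF N nc[OF N], of z] by blast
    have "s \<in> Q k"
      unfolding Q_def
    proof clarsimp
      fix M assume M: "maximal_ideal M" "k \<le> W M"
      show "s \<in> M"
      proof (rule ccontr)
        assume "s \<notin> M"
        then have "val M z \<le> enat (W N)" using s(2) M(1) z(2) order_trans by blast
        then have "W M \<le> W N" using W_le[OF z(1)] by blast
        then show False using M(2) False by simp
      qed
    qed
    then show ?thesis using s(1) val_eq_0_iff[OF N] False by auto
  qed
  have prod_ge: "enat (length (filter (\<lambda>k. k \<le> W N) ks)) \<le> val N y"
    if N: "maximal_ideal N" and "y \<in> ideal_prod_list (map Q ks)" for N ks y
    using that(2)
  proof (induction ks arbitrary: y)
    case Nil
    then show ?case by (simp add: zero_enat_def[symmetric])
  next
    case (Cons k ks)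
    let ?n = "\<lambda>ks. length (filter (\<lambda>k. k \<le> W N) ks)"
    have "ideal_mult (Q k) (ideal_prod_list (map Q ks)) \<subseteq> {y. enat (?n (k # ks)) \<le> val N y}"
    proof (rule ideal_mult_subset[OF is_ideal_val_ge[OF N]])
      fix a b assume a: "a \<in> Q k" and b: "b \<in> ideal_prod_list (map Q ks)"
      have "(if k \<le> W N then 1 else 0) \<le> val N a"
        using a one_le_val_iff[OF N] N by (auto simp: Q_def)
      moreover have "enat (?n ks) \<le> val N b" using Cons.IH b .
      ultimately have "(if k \<le> W N then 1 else 0) + enat (?n ks) \<le> val N (a * b)"
        unfolding val_mult[OF N] by (rule add_mono)
      then show "a * b \<in> {y. enat (?n (k # ks)) \<le> val N y}"
        by (auto simp: one_enat_def split: if_splits)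
    qed
    then show ?case using Cons.prems by auto
  qed
  have prod_le: "\<exists>y\<in>ideal_prod_list (map Q ks). val N y \<le> enat (length (filter (\<lambda>k. k \<le> W N) ks))"
    if N: "maximal_ideal N" and "\<forall>k\<in>set ks. 0 < k" for N ks
    using that(2)
  proof (induction ks)
    case Nil
    then show ?case using val_1[OF N] by (auto intro!: exI[of _ 1])
  next
    case (Cons k ks)
    let ?n = "\<lambda>ks. length (filter (\<lambda>k. k \<le> W N) ks)"
    obtain y where y: "y \<in> ideal_prod_list (map Q ks)" "val N y \<le> enat (?n ks)" using Cons by auto
    obtain q where q: "q \<in> Q k" "val N q \<le> (if k \<le> W N then 1 else 0)"
      using one[OF N, of k] Cons.prems by auto
    have "val N (q * y) \<le> (if k \<le> W N then 1 else 0) + enat (?n ks)"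
      unfolding val_mult[OF N] using q(2) y(2) by (rule add_mono)
    also have "\<dots> = enat (?n (k # ks))" by (simp add: one_enat_def)
    finally show ?case using ideal_multI[OF q(1) y(1)] by auto
  qed
  \<comment> \<open>The indices run from 1 to \<open>B\<close>, and \<open>W N \<le> B\<close>, so
    exactly \<open>W N\<close> of them count at \<open>N\<close>.\<close>
  have count: "length (filter (\<lambda>k. k \<le> W N) [1..<Suc B]) = W N" if "maximal_ideal N" for N
  proof -
    have "length (filter (\<lambda>k. k \<le> W N) [1..<Suc B]) = card {k. k \<le> W N \<and> k \<in> {1..<Suc B}}"
      by (subst distinct_length_filter) (auto intro!: arg_cong[where f = card])
    also have "{k. k \<le> W N \<and> k \<in> {1..<Suc B}} = {1..W N}" using WB[OF that] by auto
    finally show ?thesis by simp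
  qed
  have "I = ideal_prod_list (map Q [1..<Suc B])"
  proof
    show "I \<subseteq> ideal_prod_list (map Q [1..<Suc B])"
    proof
      fix y assume y: "y \<in> I"
      show "y \<in> ideal_prod_list (map Q [1..<Suc B])"
      proof (rule ideal_mem_if_val[OF is_ideal_ideal_prod_list])
        fix N :: "'a set" assume N: "maximal_ideal N"
        show "\<exists>z\<in>ideal_prod_list (map Q [1..<Suc B]). val N z \<le> val N y"
          using prod_le[OF N, of "[1..<Suc B]"] le_val[OF y, of N] count[OF N]
          by (auto simp del: upt_Suc intro: order_trans)
      qed
    qed
    show "ideal_prod_list (map Q [1..<Suc B]) \<subseteq> I"
    proof
      fix y assume y: "y \<in> ideal_prod_list (map Q [1..<Suc B])"
      show "y \<in> I"
      proof (rule ideal_mem_if_val[OF I])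
        fix N :: "'a set" assume N: "maximal_ideal N"
        show "\<exists>z\<in>I. val N z \<le> val N y"
          using prod_ge[OF N y] W_attained[OF N] count[OF N]
          by (auto simp del: upt_Suc intro: order_trans)
      qed
    qed
  qed
  then show ?thesis using radQ by (intro exI[of _ "map Q [1..<Suc B]"]) (auto simp del: upt_Suc)
qed

section \<open>Isolated maximal ideals\<close>

text \<open>The induction divides \<open>x\<close> by \<open>N\<close> until the quotient leaves \<open>N\<close>.\<close>

lemma invertible_maximal_isolated:
  fixes x :: 'a
  assumes N: "maximal_ideal N" "invertible_ideal N" and "x \<noteq> 0"
  shows "\<exists>e. e \<notin> N \<and> (\<forall>N'. maximal_ideal N' \<and> N' \<noteq> N \<and> x \<in> N' \<longrightarrow> e \<in> N')"
proof -
  have step: "\<exists>e. e \<notin> N \<and> (\<forall>N'. maximal_ideal N' \<and> N' \<noteq> N \<and> x \<in> N' \<longrightarrow> e \<in> N')"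
    if "val N x \<le> enat m" for x m
    using that
  proof (induction m arbitrary: x)
    case 0
    then have "x \<notin> N" using val_eq_0_iff[OF N(1)] by (simp add: zero_enat_def[symmetric])
    then show ?case by blast
  next
    case (Suc m)
    show ?case
    proof (cases "x \<in> N")
      case True
      \<comment> \<open>With this \<open>?P\<close>, the product \<open>N ?P\<close> has value at
        least \<open>m + 2\<close>, so it misses \<open>x\<close>; the cofactor \<open>y\<close>
        then has value at most \<open>m\<close>.\<close>
      let ?P = "{a. enat (Suc m) \<le> val N a}"
      have "ideal_mult N ?P \<subseteq> {a. enat (Suc (Suc m)) \<le> val N a}"
      proof (rule ideal_mult_subset[OF is_ideal_val_ge[OF N(1)]])
        fix a b assume "a \<in> N" "b \<in> ?P"
        then have "1 + enat (Suc m) \<le> val N a + val N b"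
          using one_le_val_iff[OF N(1)] by (intro add_mono) auto
        then show "a * b \<in> {a. enat (Suc (Suc m)) \<le> val N a}"
          using N(1) by (simp add: val_mult one_enat_def)
      qed
      moreover have "x \<notin> {a. enat (Suc (Suc m)) \<le> val N a}"
        using Suc.prems by (cases "val N x") auto
      ultimately have "x \<notin> ideal_mult N ?P" by blast
      then obtain y where y: "y \<notin> ?P" "\<And>j. j \<in> N \<Longrightarrow> x dvd y * j"
        using invertible_ideal_cofactor[OF N(2) True is_ideal_val_ge[OF N(1)]] by blast
      have "val N y \<le> enat m" using y(1) by (cases "val N y") auto
      then obtain e where e: "e \<notin> N"
        "\<And>N'. maximal_ideal N' \<Longrightarrow> N' \<noteq> N \<Longrightarrow> y \<in> N' \<Longrightarrow> e \<in> N'" using Suc.IH by blast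
      have "e \<in> N'" if N': "maximal_ideal N'" "N' \<noteq> N" "x \<in> N'" for N'
      proof -
        \<comment> \<open>Since \<open>j\<close> is a unit at \<open>N'\<close> and \<open>x\<close>
          divides \<open>y * j\<close>, the quotient \<open>y\<close> still lies in
          \<open>N'\<close>.\<close>
        obtain j where j: "j \<in> N" "j \<notin> N'" using maximal_ideal_not_subset N' N(1) by blast
        then obtain c where "y * j = x * c" using y(2) by (auto elim: dvdE)
        then have "y * j \<in> N'" using ideal_mult_right[OF maximal_idealD(1)[OF N'(1)] N'(3)] by simp
        then show ?thesis using maximal_ideal_prime[OF N'(1)] j(2) e(2) N' by blast
      qed
      then show ?thesis using e(1) by blast
    qed blast
  qed
  obtain m where "val N x = enat m" using assms(3) val_eq_infinity by (cases "val N x") auto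
  then show ?thesis by (intro step[of x m]) simp
qed

text \<open>By isolation, a uniformizer at \<open>N\<close> has value 0 at all other maximal ideals
  in a neighbourhood of \<open>N\<close>.\<close>

lemma invertible_maximal_noncritical:
  assumes N: "maximal_ideal N" "invertible_ideal (N :: 'a set)"
  shows "noncritical N"
proof -
  obtain p where p: "val N p = 1" using uniformizer[OF N(1)] by blast
  then have "p \<noteq> 0" by auto
  then obtain e where e: "e \<notin> N" "\<And>N'. maximal_ideal N' \<Longrightarrow> N' \<noteq> N \<Longrightarrow> p \<in> N' \<Longrightarrow> e \<in> N'"
    using invertible_maximal_isolated[OF N] by blast
  have "val N' p \<le> 1" if N': "maximal_ideal N'" "e \<notin> N'" for N'
  proof (cases "N' = N")
    case False
    then have "val N' p = 0" using e(2) val_eq_0_iff[OF N'(1)] N' by blast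
    then show ?thesis by simp
  qed (simp add: p)
  then show ?thesis unfolding noncritical_def using p e(1) by blast
qed

text \<open>A Zariski-closed set all of whose points are isolated is finite by compactness. Here and in
  \<open>val_bounded\<close>, compactness takes this form: the elements \<open>e\<close> for which the claim holds off the
  maximal ideals containing \<open>e\<close> form an ideal, which lies in no maximal ideal.\<close>

lemma finite_maximal_ideals_containing:
  fixes x l :: 'a
  assumes "x \<noteq> 0" and l: "l \<notin> M"
    and inv: "\<And>N. maximal_ideal N \<Longrightarrow> x \<in> N \<Longrightarrow> N \<noteq> M \<Longrightarrow> invertible_ideal N"
  shows "finite {N. maximal_ideal N \<and> x \<in> N \<and> l \<in> N}"
proof -
  let ?F = "\<lambda>e. {N. maximal_ideal N \<and> x \<in> N \<and> l \<in> N \<and> e \<notin> N}"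
  have "1 \<in> {e. finite (?F e)}"
  proof (rule one_in_ideal_if_avoids_maximals)
    show "is_ideal {e. finite (?F e)}"
      unfolding is_ideal_iff
    proof (intro conjI ballI allI)
      have "?F 0 = {}" using ideal_0 maximal_idealD(1) by blast
      then show "0 \<in> {e. finite (?F e)}" by (simp only: mem_Collect_eq finite.emptyI)
    next
      fix a b assume "a \<in> {e. finite (?F e)}" "b \<in> {e. finite (?F e)}"
      then have "finite (?F a \<union> ?F b)" by simp
      moreover have "?F (a + b) \<subseteq> ?F a \<union> ?F b" using ideal_add maximal_idealD(1) by blast
      ultimately show "a + b \<in> {e. finite (?F e)}" using finite_subset by blast
    next
      fix r a assume "a \<in> {e. finite (?F e)}"
      moreover have "?F (r * a) \<subseteq> ?F a" using ideal_mult_left maximal_idealD(1) by blast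
      ultimately show "r * a \<in> {e. finite (?F e)}" using finite_subset by blast
    qed
  next
    fix N :: "'a set" assume N: "maximal_ideal N"
    show "\<exists>e\<in>{e. finite (?F e)}. e \<notin> N"
    proof (cases "x \<in> N \<and> l \<in> N")
      case True
      then have "invertible_ideal N" using inv[OF N] l by auto
      then obtain e where e: "e \<notin> N"
        "\<And>N'. maximal_ideal N' \<Longrightarrow> N' \<noteq> N \<Longrightarrow> x \<in> N' \<Longrightarrow> e \<in> N'"
        using invertible_maximal_isolated[OF N _ assms(1)] by blast
      then have "?F e \<subseteq> {N}" by blast
      then show ?thesis using e(1) finite_subset by blast
    next
      case False
      \<comment> \<open>Whichever of \<open>x\<close> and \<open>l\<close> lies outside
        \<open>N\<close> serves as the required element.\<close>
      have "?F x = {}" "?F l = {}" by auto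
      then have "x \<in> {e. finite (?F e)}" "l \<in> {e. finite (?F e)}"
        by (simp_all only: mem_Collect_eq finite.emptyI)
      then show ?thesis using False by blast
    qed
  qed
  then have "finite (?F 1)" by simp
  moreover have "?F 1 = {N. maximal_ideal N \<and> x \<in> N \<and> l \<in> N}"
    using one_notin_maximal by blast
  ultimately show ?thesis by simp
qed

text \<open>By the Chinese remainder idea there is an \<open>a\<close> congruent to 1 modulo
  \<open>M\<close> and to 0 modulo every \<open>N \<in> F\<close>; it glues a uniformizer at
  \<open>M\<close> to 1 at each such \<open>N\<close>.\<close>

lemma uniformizer_avoiding_maximal_ideals:
  assumes M: "maximal_ideal (M :: 'a set)"
    and fin: "finite F" "M \<notin> F" "\<And>N. N \<in> F \<Longrightarrow> maximal_ideal N"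
  shows "\<exists>x. val M x = 1 \<and> (\<forall>N\<in>F. x \<notin> N)"
proof -
  note idM = maximal_idealD(1)[OF M]
  have "\<exists>a. (\<forall>N\<in>F. a \<in> N) \<and> 1 - a \<in> M"
    using fin
  proof (induction F rule: finite_induct)
    case empty
    then show ?case using ideal_0[OF idM] by (intro exI[of _ 1]) auto
  next
    case (insert N F)
    then obtain a where a: "\<forall>N\<in>F. a \<in> N" "1 - a \<in> M" by auto
    have N: "maximal_ideal N" "M \<noteq> N" using insert.prems by auto
    obtain b where b: "b \<in> N" "1 - b \<in> M" using maximal_ideal_comaximal[OF M N] .
    have "(1 - a) + a * (1 - b) \<in> M" using ideal_add[OF idM a(2) ideal_mult_left[OF idM b(2)]] .
    moreover have "(1 - a) + a * (1 - b) = 1 - a * b" by (simp add: algebra_simps)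
    ultimately have "1 - a * b \<in> M" by simp
    moreover have "a * b \<in> N'" if "N' \<in> insert N F" for N'
    proof (cases "N' = N")
      case True
      then show ?thesis using b(1) ideal_mult_left[OF maximal_idealD(1)[OF N(1)]] by simp
    next
      case False
      then have "a \<in> N'" using that a(1) by simp
      moreover have "is_ideal N'" using insert.prems(2)[OF that] by (rule maximal_idealD(1))
      ultimately show ?thesis by (intro ideal_mult_right)
    qed
    ultimately show ?case by blast
  qed
  then obtain a where a: "\<forall>N\<in>F. a \<in> N" "1 - a \<in> M" by blast
  have "a \<notin> M"
  proof
    assume "a \<in> M"
    then have "(1 - a) + a \<in> M" using a(2) ideal_add[OF idM] by blast
    then show False using one_notin_maximal[OF M] by simp
  qed
  obtain p where p: "val M p = 1" using uniformizer[OF M] by blast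
  \<comment> \<open>At \<open>M\<close> the first summand has value 1 and the second at least 2;
    modulo each \<open>N \<in> F\<close> the sum is congruent to 1.\<close>
  let ?x = "a * p + (1 - a) * (1 - a)"
  have "(1 - a) * (1 - a) \<in> ideal_mult M M" using a(2) by (intro ideal_multI)
  then have two: "2 \<le> val M ((1 - a) * (1 - a))"
    using ideal_mult_subset_val_2[OF M order_refl order_refl] by blast
  have ap: "val M (a * p) = 1" using M p \<open>a \<notin> M\<close> val_eq_0_iff[OF M, of a] by (simp add: val_mult)
  have "p \<in> M" using p one_le_val_iff[OF M, of p] by simp
  then have "?x \<in> M" using ideal_add[OF idM] ideal_mult_left[OF idM] a(2) by simp
  then have "1 \<le> val M ?x" using one_le_val_iff[OF M] by simp
  moreover have "\<not> 2 \<le> val M ?x"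
  proof
    assume "2 \<le> val M ?x"
    moreover have "2 \<le> val M (- 1 * ((1 - a) * (1 - a)))"
      unfolding val_mult[OF M, of "- 1"] using two by (rule add_increasing[OF zero_le])
    ultimately have "2 \<le> val M (?x + - 1 * ((1 - a) * (1 - a)))"
      using val_add[OF M, of ?x "- 1 * ((1 - a) * (1 - a))"] by (auto simp: min_def split: if_splits)
    then have "2 \<le> val M (a * p)" by simp
    then show False using ap by (simp add: one_enat_def numeral_eq_enat)
  qed
  ultimately have "val M ?x = 1" by (cases "val M ?x") (auto simp: one_enat_def numeral_eq_enat)
  moreover have "?x \<notin> N" if "N \<in> F" for N
  proof
    have N: "maximal_ideal N" "a \<in> N" using fin(3) a(1) that by auto
    note idN = maximal_idealD(1)[OF N(1)]
    have "1 - a \<notin> N"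
    proof
      assume "1 - a \<in> N"
      then have "(1 - a) + a \<in> N" using N(2) ideal_add[OF idN] by blast
      then show False using one_notin_maximal[OF N(1)] by simp
    qed
    assume "?x \<in> N"
    then have "?x + (- p) * a \<in> N" using ideal_add[OF idN _ ideal_mult_left[OF idN N(2)]] by blast
    then have "(1 - a) * (1 - a) \<in> N" by (simp add: mult.commute)
    then show False using maximal_ideal_prime[OF N(1)] \<open>1 - a \<notin> N\<close> by blast
  qed
  ultimately show ?thesis by blast
qed

section \<open>Ideal factorizations at a maximal ideal\<close>

lemma maximal_ideal_contains_factor:
  assumes M: "maximal_ideal (M :: 'a set)" and "ideal_prod_list Is \<subseteq> M"
  shows "\<exists>I\<in>set Is. I \<subseteq> M"
  using assms(2)
proof (induction Is)
  case Nil
  then show ?case using one_notin_maximal[OF M] by auto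
next
  case (Cons I Is)
  show ?case
  proof (rule ccontr)
    assume "\<not> ?case"
    then obtain a b where "a \<in> I" "a \<notin> M" "b \<in> ideal_prod_list Is" "b \<notin> M" using Cons.IH by auto
    moreover from this have "a * b \<in> M" using ideal_multI[of a I b] Cons.prems by auto
    ultimately show False using maximal_ideal_prime[OF M] by blast
  qed
qed

text \<open>Only one factor can lie in \<open>M\<close>, so \<open>l\<close> can be a product of elements of the others.\<close>

lemma complementary_factor_outside:
  assumes M: "maximal_ideal (M :: 'a set)" and id: "\<And>J. J \<in> set Is \<Longrightarrow> is_ideal J"
    and R: "R \<in> set Is" "R \<subseteq> M" and "\<not> ideal_prod_list Is \<subseteq> {a. 2 \<le> val M a}"
  shows "\<exists>l. l \<notin> M \<and> (\<forall>r\<in>R. l * r \<in> ideal_prod_list Is)"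
  using assms(2-)
proof (induction Is)
  case (Cons J Is)
  let ?P = "ideal_prod_list Is"
  have not2: "\<not> ideal_mult J ?P \<subseteq> {a. 2 \<le> val M a}" using Cons.prems by simp
  show ?case
  proof (cases "R = J")
    case True
    then have "\<not> ?P \<subseteq> M" using not2 ideal_mult_subset_val_2[OF M R(2)] by blast
    then obtain l where l: "l \<in> ?P" "l \<notin> M" by blast
    then have "\<forall>r\<in>R. l * r \<in> ideal_prod_list (J # Is)"
      using ideal_multI[of _ J l ?P] True by (auto simp: mult.commute)
    then show ?thesis using l(2) by blast
  next
    case False
    then have R': "R \<in> set Is" using Cons.prems by simp
    have "?P \<subseteq> R" using ideal_prod_list_subset[OF R'] Cons.prems by simp
    then have "\<not> J \<subseteq> M" using not2 ideal_mult_subset_val_2[OF M] R(2) by blast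
    then obtain j where j: "j \<in> J" "j \<notin> M" by blast
    have "\<not> ?P \<subseteq> {a. 2 \<le> val M a}"
      using not2 ideal_mult_le_right[OF is_ideal_ideal_prod_list, of J Is] by blast
    then obtain l where l: "l \<notin> M" "\<forall>r\<in>R. l * r \<in> ?P"
      using Cons.IH Cons.prems R' by auto
    have "j * l \<notin> M" using maximal_ideal_prime[OF M] j l by blast
    moreover have "\<forall>r\<in>R. (j * l) * r \<in> ideal_prod_list (J # Is)"
      using ideal_multI[of j J _ ?P] j l(2) by (simp add: mult.assoc)
    ultimately show ?thesis by blast
  qed
qed simp

section \<open>ISP-domains with finitely many noninvertible maximal ideals\<close>

text \<open>Choose in each of the finitely many bad \<open>N\<close> an element outside
  \<open>M\<close>; off their product, \<open>x\<close> has value at most 1.\<close>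

lemma noncritical_if_finitely_many_squares:
  fixes x :: 'a
  assumes M: "maximal_ideal M" "val M x = 1"
    and fin: "finite {N. maximal_ideal N \<and> 2 \<le> val N x}" (is "finite ?T")
  shows "noncritical M"
proof -
  have "M \<notin> ?T" using M(2) by (simp add: one_enat_def numeral_eq_enat)
  then have "\<forall>N\<in>?T. \<exists>s. s \<in> N \<and> s \<notin> M" using maximal_ideal_not_subset[OF M(1)] by blast
  then obtain f where f: "\<And>N. N \<in> ?T \<Longrightarrow> f N \<in> N \<and> f N \<notin> M" by metis
  have "prod f ?T \<notin> M" using maximal_ideal_prod[OF M(1) fin] f by blast
  moreover have "val N x \<le> 1" if N: "maximal_ideal N" "prod f ?T \<notin> N" for N
  proof (rule ccontr)
    assume "\<not> val N x \<le> 1"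
    then have "2 \<le> val N x" by (cases "val N x") (auto simp: one_enat_def numeral_eq_enat)
    then have "N \<in> ?T" using N(1) by simp
    then have "prod f ?T \<in> N" using maximal_ideal_prod[OF N(1) fin] f by blast
    then show False using N(2) by simp
  qed
  ultimately show ?thesis unfolding noncritical_def using M(2) by blast
qed

text \<open>Suppose \<open>val N x \<ge> 2\<close> for infinitely many \<open>N\<close>, and split these \<open>N\<close> into infinite sets \<open>S\<close>
  and \<open>S'\<close>. The ideal of all elements of \<open>M\<close> having value at least \<open>2\<close> on \<open>S\<close> is not in the
  square of \<open>M\<close>, hence exactly one of its ISP-factors lies in \<open>M\<close>. A radical factor
  forces the remaining ones to vanish on \<open>S\<close>; the invertible factor \<open>J\<close> avoids \<open>S'\<close>, so that
  \<open>x J\<^sup>-\<^sup>1\<close> vanishes on \<open>S'\<close>. Either way some \<open>l \<notin> M\<close> lies in infinitely many of the isolated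
  maximal ideals containing \<open>x\<close>.\<close>

lemma isp_imp_finitely_many_squares:
  fixes x :: 'a
  assumes isp: "isp_domain A" and M: "maximal_ideal M" and x: "val M x = 1"
    and inv: "\<And>N. maximal_ideal N \<Longrightarrow> x \<in> N \<Longrightarrow> N \<noteq> M \<Longrightarrow> invertible_ideal N"
  shows "finite {N. maximal_ideal N \<and> 2 \<le> val N x}" (is "finite ?T")
proof (rule ccontr)
  assume inf: "infinite ?T"
  obtain C :: "nat \<Rightarrow> 'a set set" where C: "pairwise (\<lambda>i j. disjnt (C i) (C j)) UNIV"
    "(\<Union>i. C i) \<subseteq> ?T" "\<And>i. infinite (C i)"
    using infinite_infinite_partition[OF inf] by blast
  define S S' where "S = C 0" and "S' = C 1"
  have S: "S \<subseteq> ?T" "S' \<subseteq> ?T" "infinite S" "infinite S'" "S \<inter> S' = {}"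
    using C unfolding S_def S'_def pairwise_def disjnt_def by (blast, blast, auto)
  have x0: "x \<noteq> 0" using x by auto
  have MT: "M \<notin> ?T" using x by (simp add: one_enat_def numeral_eq_enat)
  have xT: "x \<in> N" if "N \<in> ?T" for N
  proof -
    have "(1::enat) \<le> 2" by (simp add: one_enat_def numeral_eq_enat)
    then show ?thesis using that one_le_val_iff[of N x] order_trans by blast
  qed
  \<comment> \<open>If \<open>l \<notin> M\<close>, only finitely many maximal ideals contain both
    \<open>x\<close> and \<open>l\<close>, so \<open>l\<close> cannot lie in all members of an
    infinite \<open>U\<close>.\<close>
  have no_l: "l \<in> M" if "infinite U" "U \<subseteq> ?T" "\<And>N. N \<in> U \<Longrightarrow> l \<in> N" for l U
  proof (rule ccontr)
    assume "l \<notin> M"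
    then have "finite {N. maximal_ideal N \<and> x \<in> N \<and> l \<in> N}"
      using finite_maximal_ideals_containing[OF x0 _ inv] by blast
    moreover have "U \<subseteq> {N. maximal_ideal N \<and> x \<in> N \<and> l \<in> N}" using that xT by blast
    ultimately show False using that(1) finite_subset by blast
  qed
  define I where "I = {y \<in> M. \<forall>N\<in>S. 2 \<le> val N y}"
  have xI: "x \<in> I" unfolding I_def using S(1) one_le_val_iff[OF M, of x] x by auto
  have idI: "is_ideal I"
  proof -
    have "is_ideal (M \<inter> (\<Inter>N\<in>S. {y. 2 \<le> val N y}))"
      using maximal_idealD(1)[OF M] is_ideal_val_ge[of _ 2] S(1)
      unfolding is_ideal_iff by blast
    moreover have "M \<inter> (\<Inter>N\<in>S. {y. 2 \<le> val N y}) = I" unfolding I_def by auto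
    ultimately show ?thesis by simp
  qed
  have I2: "\<not> I \<subseteq> {a. 2 \<le> val M a}"
    using xI x by (auto simp: one_enat_def numeral_eq_enat)
  have "I \<noteq> UNIV" using one_notin_maximal[OF M] by (auto simp: I_def)
  moreover have "I \<noteq> {0}" using xI x0 by auto
  ultimately obtain J Qs where J: "invertible_ideal J"
    and Qs: "\<forall>Q\<in>set Qs. radical_ideal Q \<and> Q \<noteq> UNIV" and "I = ideal_mult J (ideal_prod_list Qs)"
    using isp idI unfolding isp_domain_def by blast
  then have I_eq: "I = ideal_prod_list (J # Qs)" by simp
  have ids: "is_ideal K" if "K \<in> set (J # Qs)" for K
    using that J Qs by (auto simp: invertible_ideal_def radical_ideal_def)
  have "ideal_prod_list (J # Qs) \<subseteq> M" using I_eq I_def by blast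
  then obtain R where R: "R \<in> set (J # Qs)" "R \<subseteq> M"
    using maximal_ideal_contains_factor[OF M] by blast
  have xR: "x \<in> R" using ideal_prod_list_subset[OF R(1) ids] xI I_eq by blast
  have "R = J \<or> R \<in> set Qs" using R(1) by auto
  then show False
  proof
    assume "R \<in> set Qs"
    then have rad: "radical_ideal R" using Qs by blast
    obtain l where l: "l \<notin> M" "\<forall>r\<in>R. l * r \<in> I"
      using complementary_factor_outside[OF M ids R] I2 unfolding I_eq by blast
    have "l \<in> N" if NS: "N \<in> S" for N
    proof (rule ccontr)
      assume "l \<notin> N"
      have N: "maximal_ideal N" using NS S(1) by blast
      \<comment> \<open>\<open>l * r \<in> I\<close> has value at least 2 at \<open>N\<close>, but
        \<open>r\<close> contributes at most 1, so \<open>l\<close> cannot have value 0.\<close>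
      obtain r where r: "r \<in> R" "val N r \<le> 1" using radical_ideal_val_le_1[OF N rad xR x0] by blast
      have "2 \<le> val N (l * r)" using l(2) r(1) NS unfolding I_def by blast
      then have "2 \<le> val N r" using \<open>l \<notin> N\<close> val_eq_0_iff[OF N, of l] by (simp add: val_mult[OF N])
      then have "(2::enat) \<le> 1" using r(2) order_trans by blast
      then show False by (simp add: one_enat_def numeral_eq_enat)
    qed
    then show False using no_l[OF S(3,1)] l(1) by blast
  next
    assume "R = J"
    then have J_le: "J \<subseteq> M" "x \<in> J" using R xR by auto
    have "x \<notin> ideal_mult J M"
      using ideal_mult_subset_val_2[OF M J_le(1) order_refl] x
      by (auto simp: one_enat_def numeral_eq_enat)
    then obtain l where l: "l \<notin> M" "\<And>j. j \<in> J \<Longrightarrow> x dvd l * j"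
      using invertible_ideal_cofactor[OF J J_le(2) maximal_idealD(1)[OF M]] by blast
    have "l \<in> N" if NS: "N \<in> S'" for N
    proof -
      have N: "maximal_ideal N" "x \<in> N" "N \<noteq> M" "N \<notin> S" using NS S xT MT by blast+
      \<comment> \<open>\<open>e\<close> lies in \<open>M\<close> and in all members of
        \<open>S\<close> but not in \<open>N\<close>. Its square therefore lies in
        \<open>I \<subseteq> J\<close> and shows that \<open>J\<close> is not contained in
        \<open>N\<close>; since \<open>x\<close> divides \<open>l * (e * e)\<close>, this forces
        \<open>l \<in> N\<close>.\<close>
      obtain e where e: "e \<notin> N"
        "\<And>N'. maximal_ideal N' \<Longrightarrow> N' \<noteq> N \<Longrightarrow> x \<in> N' \<Longrightarrow> e \<in> N'"
        using invertible_maximal_isolated[OF N(1) inv[OF N(1-3)] x0] by blast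
      have "e \<in> M" using e(2)[OF M] N(3) one_le_val_iff[OF M, of x] x by simp
      then have "e * e \<in> M" using maximal_ideal_prime[OF M] by blast
      moreover have "2 \<le> val N' (e * e)" if "N' \<in> S" for N'
      proof -
        have N': "maximal_ideal N'" "x \<in> N'" "N' \<noteq> N" using that S(1) xT N(4) by blast+
        then have "e \<in> N'" using e(2) by blast
        then have "e * e \<in> ideal_mult N' N'" by (intro ideal_multI)
        then show ?thesis using ideal_mult_subset_val_2[OF N'(1) order_refl order_refl] by blast
      qed
      ultimately have "e * e \<in> I" unfolding I_def by blast
      then have "e * e \<in> J" using ideal_prod_list_subset[of J "J # Qs", OF _ ids] I_eq by auto
      moreover have "e * e \<notin> N" using e(1) maximal_ideal_prime[OF N(1)] by blast
      moreover obtain c where "l * (e * e) = x * c" using l(2)[OF \<open>e * e \<in> J\<close>] by (rule dvdE)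
      moreover have "x * c \<in> N" using ideal_mult_right[OF maximal_idealD(1)[OF N(1)] N(2)] .
      ultimately show ?thesis using maximal_ideal_prime[OF N(1), of l "e * e"] by metis
    qed
    then show False using no_l[OF S(4,2)] l(1) by blast
  qed
qed

text \<open>Finiteness enters here: choosing \<open>x\<close> outside the other noninvertible
  maximal ideals makes every maximal ideal containing \<open>x\<close>, except possibly
  \<open>M\<close>, invertible and so isolated.\<close>

lemma isp_imp_noncritical:
  assumes isp: "isp_domain A" and fin: "finite {M :: 'a set. maximal_ideal M \<and> \<not> invertible_ideal M}"
    and M: "maximal_ideal (M :: 'a set)"
  shows "noncritical M"
proof (cases "invertible_ideal M")
  case True
  then show ?thesis using invertible_maximal_noncritical M by blast
next
  case False
  let ?F = "{M :: 'a set. maximal_ideal M \<and> \<not> invertible_ideal M} - {M}"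
  obtain x where x: "val M x = 1" "\<And>N. N \<in> ?F \<Longrightarrow> x \<notin> N"
    using uniformizer_avoiding_maximal_ideals[OF M, of ?F] fin by blast
  then have "finite {N. maximal_ideal N \<and> 2 \<le> val N x}"
    by (intro isp_imp_finitely_many_squares[OF isp M]) auto
  then show ?thesis using noncritical_if_finitely_many_squares[OF M x(1)] by blast
qed

lemma isp_imp_sp:
  assumes "isp_domain A" "finite {M :: 'a set. maximal_ideal M \<and> \<not> invertible_ideal M}"
  shows "sp_domain A"
  unfolding sp_domain_def
proof (intro allI impI)
  fix I :: "'a set" assume I: "is_ideal I"
  show "\<exists>Qs. (\<forall>Q\<in>set Qs. radical_ideal Q) \<and> I = ideal_prod_list Qs"
  proof (cases "I = {0}")
    case True
    \<comment> \<open>The zero ideal of a domain is radical and is its own factorization.\<close>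
    have "radical I = I" unfolding True radical_def by (auto intro: exI[of _ 1])
    then have "radical_ideal I" using I by (simp add: radical_ideal_def)
    moreover have "I = ideal_prod_list [I]"
      using ideal_mult_le_left[OF I, of UNIV] ideal_0[OF is_ideal_ideal_mult] True by auto
    ultimately show ?thesis by (intro exI[of _ "[I]"]) simp
  next
    case False
    then obtain x where "x \<in> I" "x \<noteq> 0" using ideal_0[OF I] by blast
    then show ?thesis
      using product_of_radicals_if_noncritical[OF isp_imp_noncritical[OF assms] I] by blast
  qed
qed

end

text \<open>The whole ring serves as invertible factor. Unit factors are dropped because ISP asks
  for proper ones; some factor remains because \<open>I\<close> is proper.\<close>

lemma sp_imp_isp:
  assumes "sp_domain TYPE('a::idom)"
  shows "isp_domain TYPE('a)"
  unfolding isp_domain_def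
proof (intro allI impI)
  fix I :: "'a set" assume I: "is_ideal I \<and> I \<noteq> UNIV \<and> I \<noteq> {0}"
  then obtain Qs where Qs: "\<forall>Q\<in>set Qs. radical_ideal Q" "I = ideal_prod_list Qs"
    using assms unfolding sp_domain_def by blast
  let ?Qs = "filter (\<lambda>Q. Q \<noteq> UNIV) Qs"
  have I_eq: "I = ideal_prod_list ?Qs" using Qs(2) ideal_prod_list_filter_UNIV by metis
  then have "?Qs \<noteq> []" using I by (metis ideal_prod_list_Nil)
  moreover have "I = ideal_mult UNIV (ideal_prod_list ?Qs)"
    using I_eq ideal_mult_UNIV[OF is_ideal_ideal_prod_list] by metis
  ultimately show "\<exists>J Qs. invertible_ideal J \<and> Qs \<noteq> [] \<and>
      (\<forall>Q\<in>set Qs. radical_ideal Q \<and> Q \<noteq> UNIV) \<and> I = ideal_mult J (ideal_prod_list Qs)"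
    using Qs(1) invertible_ideal_UNIV by (intro exI[of _ UNIV] exI[of _ ?Qs]) auto
qed

theorem corollary14:
  assumes "almost_dedekind TYPE('a::idom)"
    and "finite {M :: 'a set. maximal_ideal M \<and> \<not> invertible_ideal M}"
  shows "isp_domain TYPE('a) \<longleftrightarrow> sp_domain TYPE('a)"
proof -
  interpret almost_dedekind_domain "TYPE('a)"
    using assms(1) by unfold_locales
  show ?thesis using isp_imp_sp assms(2) sp_imp_isp by blast
qed

end
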